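(* Let $C(p)$, $p\in\mathcal D$, be nonempty sets given by $$C(p)=\{x\in\mathcal H \mid \langle x\mid g_i(p)\rangle=f_i(p),\ i\in I_1,\ \ \langle x\mid g_i(p)\rangle\le f_i(p),\ i\in I_2\},$$ and let $P:\mathcal H\times\mathcal D\to\mathcal H$, where $P(v,p)$ is the projection of $v$ onto $C(p)$. Let $\bar p\in\mathcal D$ and $\bar v\notin C(\bar p)$. Suppose there exist an equivalent representation $\mathcal R$ of $p\mapsto C(p)$, a set $\bar K\subset\tilde I_2\cap I^{\mathcal R}_{\bar p}(P(\bar v,\bar p))$ with $$\bar v-P(\bar v,\bar p)=\sum_{i\in\tilde I_1\cup\bar K}\bar\lambda_i\tilde g_i(\bar p),\qquad \bar\lambda_i>0,\ i\in\bar K,$$ where $\tilde g_i(\bar p)$, $i\in\tilde I_1\cup\bar K$, are linearly independent, and neighbourhoods $U(\bar p)$, $W(\bar v)$ such that (a) $\bar K\subset I^{\mathcal R}_p(P(v,p))$ for all $p\in U(\bar p)$, $v\in W(\bar v)$; (b) for any sequence $p_n\to\bar p$ in $\mathcal D$ and any $L\subset(\tilde I_2\cap I^{\mathcal R}_{\bar p}(P(\bar v,\bar p)))\setminus\bar K$ such that $\tilde g_i(\bar p)$, $i\in\tilde I_1\cup\bar K\cup L$, are linearly independent, there exists a sequence $v_n\to\bar v$ such that $L\subset I^{\mathcal R}_{p_n}(P(v_n,p_n))$ for $n$ sufficiently large. If $P$ is continuous at $(\bar v,\bar p)$, then the representation $\mathcal R$ is stable at $(\bar p,\bar v,P(\bar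 v,\bar p))$.
   Context: $\mathcal H$ is a real Hilbert space with inner product $\langle\cdot\mid\cdot\rangle$, $\mathcal D$ is a nonempty subset of a normed space $\mathcal G$ with the induced topology (neighbourhoods of $\bar p$ are relative to $\mathcal D$). The index sets are $I_1=\emptyset$ or $\{1,\dots,q\}$, $I_2=\emptyset$ or $\{q+1,\dots,m\}$, $I_1\cup I_2\neq\emptyset$; $f_i:\mathcal D\to\mathbb R$, $g_i:\mathcal D\to\mathcal H$ are locally Lipschitz on $\mathcal D$. Lower Kuratowski limit: for a multifunction $F:\mathcal D\rightrightarrows\mathcal H$, $\liminf_{p\to\bar p,\,p\in\mathcal D}F(p)$ is the set of $y\in\mathcal H$ such that for every sequence $p_k\to\bar p$, $p_k\in\mathcal D$, there exist $y_k\in F(p_k)$ with $y_k\to y$. Equivalent representation: a multifunction $\mathcal R:p\mapsto R(p)$ with $R(p)=C(p)$ for all $p\in\mathcal D$, where $R(p)$ is given (together with its describing data) as $R(p)=\{x\in\mathcal H\mid\langle x\mid\tilde g_i(p)\rangle=\tilde f_i(p),\ i\in\tilde I_1,\ \langle x\mid\tilde g_i(p)\rangle\le\tilde f_i(p),\ i\in\tilde I_2\}$, with $\tilde I_1,\tilde I_2$ disjoint index sets, $\tilde I_1\cup\tilde I_2$ finite and nonempty, and $\tilde f_i:\mathcal D\to\mathbb R$, $\tilde g_i:\mathcal D\to\mathcal H$ locally Lipschitz on $\mathcal D$. Put $I^{\mathcal R}_p(x)=\{i\in\tilde I_1\cup\tilde I_2\mid\langle x\mid\tilde g_i(p)\rangle=\tilde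 f_i(p)\}$. Stable representation: for $\bar p\in\mathcal D$, $\bar v\notin C(\bar p)$, $\bar x\in C(\bar p)$, an equivalent representation $\mathcal R$ is stable at $(\bar p,\bar v,\bar x)$ if there exists a (possibly empty) set $K\subset I^{\mathcal R}_{\bar p}(\bar x)\cap\tilde I_2$ such that: (1) $\bar v-\bar x=\sum_{i\in\tilde I_1\cup K}\lambda_i\tilde g_i(\bar p)$ with $\lambda_i>0$ for $i\in K$ and $\tilde g_i(\bar p)$, $i\in\tilde I_1\cup K$, linearly independent; and (2) for every (possibly empty) $L\subset(I^{\mathcal R}_{\bar p}(\bar x)\cap\tilde I_2)\setminus K$ such that $\tilde g_i(\bar p)$, $i\in\tilde I_1\cup K\cup L$, are linearly independent, $\bar x\in\liminf_{p\to\bar p,\,p\in\mathcal D}R_{K,L}(p)$, where $R_{K,L}(p)=\{x\in\mathcal H\mid\langle x\mid\tilde g_i(p)\rangle=\tilde f_i(p),\ i\in\tilde I_1\cup K\cup L,\ \langle x\mid\tilde g_i(p)\rangle\le\tilde f_i(p),\ i\in\tilde I_2\setminus(K\cup L)\}$.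
   Formalization: In the lower Kuratowski limit the points y_k are required to lie in F(p_k) only for all sufficiently large k; demanding this for every k makes the claim false when some R_{K,L}(p) is empty for p far from p̄. *)

theory Defs
  imports "HOL-Analysis.Analysis"
begin

text \<open>
  Systems of finitely many linear equations (indices \<open>I\<^sub>1\<close>) and inequalities (indices \<open>I\<^sub>2\<close>) in a
  real inner product space whose data \<open>g i p\<close>, \<open>f i p\<close> depend on a parameter \<open>p\<close>.
\<close>

definition solution_set ::
  "'i set \<Rightarrow> 'i set \<Rightarrow> ('i \<Rightarrow> 'p \<Rightarrow> 'h) \<Rightarrow> ('i \<Rightarrow> 'p \<Rightarrow> real) \<Rightarrow> 'p \<Rightarrow> 'h::real_inner set" where
  "solution_set I\<^sub>1 I\<^sub>2 g f p =
     {x. (\<forall>i\<in>I\<^sub>1. x \<bullet> g i p = f i p) \<and> (\<forall>i\<in>I\<^sub>2. x \<bullet> g i p \<le> f i p)}"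

definition active_set ::
  "'i set \<Rightarrow> 'i set \<Rightarrow> ('i \<Rightarrow> 'p \<Rightarrow> 'h) \<Rightarrow> ('i \<Rightarrow> 'p \<Rightarrow> real) \<Rightarrow> 'p \<Rightarrow> 'h::real_inner \<Rightarrow> 'i set" where
  "active_set I\<^sub>1 I\<^sub>2 g f p x = {i \<in> I\<^sub>1 \<union> I\<^sub>2. x \<bullet> g i p = f i p}"

definition locally_lipschitz_on ::
  "'p::metric_space set \<Rightarrow> ('p \<Rightarrow> 'b::metric_space) \<Rightarrow> bool" where
  "locally_lipschitz_on D h \<longleftrightarrow> (\<forall>p\<in>D. \<exists>r>0. \<exists>L. L-lipschitz_on (cball p r \<inter> D) h)"

text \<open>
  The library's \<open>closest_point\<close> is restricted to Heine-Borel (hence finite-dimensional) spaces; this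
  is the same definition without that restriction. On nonempty closed convex subsets of a Hilbert
  space the nearest point exists and is unique.
\<close>

definition projection :: "'h::real_inner set \<Rightarrow> 'h \<Rightarrow> 'h" where
  "projection S v = (SOME x. x \<in> S \<and> (\<forall>y\<in>S. dist v x \<le> dist v y))"

text \<open>Independence of an indexed family: a vector occurring for two indices makes it dependent.\<close>

definition lin_indep_family :: "('i \<Rightarrow> 'h::real_vector) \<Rightarrow> 'i set \<Rightarrow> bool" where
  "lin_indep_family b J \<longleftrightarrow> inj_on b J \<and> independent (b ` J)"

text \<open>
  The lower Kuratowski limit as \<open>p \<rightarrow> p0\<close> within \<open>D\<close>. The approximating \<open>y k \<in> F (s k)\<close> are
  required for all sufficiently large \<open>k\<close>, which keeps the notion local at \<open>p0\<close>: demanding them for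
  every \<open>k\<close> would make the limit empty as soon as \<open>F p = {}\<close> for a single \<open>p \<in> D\<close>, however far
  from \<open>p0\<close>.
\<close>

definition lower_limit ::
  "'p::topological_space set \<Rightarrow> ('p \<Rightarrow> 'h::topological_space set) \<Rightarrow> 'p \<Rightarrow> 'h set" where
  "lower_limit D F p0 =
     {x. \<forall>s. (\<forall>k. s k \<in> D) \<and> s \<longlonglongrightarrow> p0 \<longrightarrow>
          (\<exists>y. (\<forall>\<^sub>F k in sequentially. y k \<in> F (s k)) \<and> y \<longlonglongrightarrow> x)}"

text \<open>
  A representation is its describing data \<open>(I\<^sub>1, I\<^sub>2, g, f)\<close>, not merely the multifunction
  \<open>solution_set I\<^sub>1 I\<^sub>2 g f\<close>.
\<close>

definition equivalent_representation ::
  "'p::metric_space set \<Rightarrow> ('p \<Rightarrow> 'h::real_inner set) \<Rightarrow>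
   'i set \<Rightarrow> 'i set \<Rightarrow> ('i \<Rightarrow> 'p \<Rightarrow> 'h) \<Rightarrow> ('i \<Rightarrow> 'p \<Rightarrow> real) \<Rightarrow> bool" where
  "equivalent_representation D C I\<^sub>1 I\<^sub>2 g f \<longleftrightarrow>
     I\<^sub>1 \<inter> I\<^sub>2 = {} \<and> finite (I\<^sub>1 \<union> I\<^sub>2) \<and> I\<^sub>1 \<union> I\<^sub>2 \<noteq> {} \<and>
     (\<forall>i\<in>I\<^sub>1 \<union> I\<^sub>2. locally_lipschitz_on D (f i) \<and> locally_lipschitz_on D (g i)) \<and>
     (\<forall>p\<in>D. solution_set I\<^sub>1 I\<^sub>2 g f p = C p)"

text \<open>
  \<open>solution_set (I\<^sub>1 \<union> K \<union> L) (I\<^sub>2 - (K \<union> L)) g f\<close> is the multifunction usually written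
  \<open>R\<^bsub>K,L\<^esub>\<close>, in which the inequalities with index in \<open>K \<union> L\<close> are turned into equations.
\<close>

definition stable_representation ::
  "'p::metric_space set \<Rightarrow> ('p \<Rightarrow> 'h::real_inner set) \<Rightarrow>
   'i set \<Rightarrow> 'i set \<Rightarrow> ('i \<Rightarrow> 'p \<Rightarrow> 'h) \<Rightarrow> ('i \<Rightarrow> 'p \<Rightarrow> real) \<Rightarrow> 'p \<Rightarrow> 'h \<Rightarrow> 'h \<Rightarrow> bool" where
  "stable_representation D C I\<^sub>1 I\<^sub>2 g f p0 v0 x0 \<longleftrightarrow>
     equivalent_representation D C I\<^sub>1 I\<^sub>2 g f \<and> p0 \<in> D \<and> v0 \<notin> C p0 \<and> x0 \<in> C p0 \<and>
     (\<exists>K \<subseteq> active_set I\<^sub>1 I\<^sub>2 g f p0 x0 \<inter> I\<^sub>2.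
        (\<exists>c :: 'i \<Rightarrow> real. v0 - x0 = (\<Sum>i\<in>I\<^sub>1 \<union> K. c i *\<^sub>R g i p0) \<and> (\<forall>i\<in>K. c i > 0)) \<and>
        lin_indep_family (\<lambda>i. g i p0) (I\<^sub>1 \<union> K) \<and>
        (\<forall>L \<subseteq> (active_set I\<^sub>1 I\<^sub>2 g f p0 x0 \<inter> I\<^sub>2) - K.
           lin_indep_family (\<lambda>i. g i p0) (I\<^sub>1 \<union> K \<union> L) \<longrightarrow>
           x0 \<in> lower_limit D (solution_set (I\<^sub>1 \<union> K \<union> L) (I\<^sub>2 - (K \<union> L)) g f) p0))"

end

theory Submission
  imports Defs
begin

text \<open>
  Fix an index set \<open>L\<close> that stability asks about and a sequence \<open>s n \<rightarrow> pbar\<close> in \<open>D\<close>. Points of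
  \<open>R\<^bsub>K,L\<^esub> (s n)\<close> converging to \<open>P vbar pbar\<close> are obtained by projecting: hypothesis \<open>b\<close> supplies
  \<open>v n \<rightarrow> vbar\<close> for which the projections \<open>P (v n) (s n)\<close> eventually make the inequalities in \<open>L\<close>
  tight. Since \<open>(v n, s n)\<close> eventually enters \<open>W \<times> U\<close>, hypothesis \<open>a\<close> makes those in \<open>Kbar\<close> tight
  as well; being a projection, \<open>P (v n) (s n)\<close> lies in \<open>C (s n)\<close>, so it satisfies all remaining
  constraints and thus belongs to \<open>R\<^bsub>K,L\<^esub> (s n)\<close>. Continuity of \<open>P\<close> at \<open>(vbar, pbar)\<close> gives the
  convergence. The set \<open>K\<close> demanded by stability is \<open>Kbar\<close> itself.

  Membership in \<open>C (s n)\<close> rests on the existence of nearest points in nonempty closed convex sets of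
  a Hilbert space (\<open>nearest_point_exists\<close>): the choice in \<open>projection\<close> is meaningful only because a
  minimizer exists.
\<close>

lemma parallelogram_law:
  fixes a b :: "'h::real_inner"
  shows "(norm (a + b))\<^sup>2 + (norm (a - b))\<^sup>2 = 2 * (norm a)\<^sup>2 + 2 * (norm b)\<^sup>2"
  by (simp add: power2_norm_eq_inner inner_simps)

text \<open>
  Squared distances to \<open>v\<close> along a minimizing sequence exceed their infimum \<open>d\<close> by ever smaller
  amounts, while the midpoint of two of its points stays in \<open>S\<close> and so has squared distance at least
  \<open>d\<close>. The parallelogram law turns this into the Cauchy property.
\<close>

lemma nearest_point_exists:
  fixes S :: "'h::real_inner set"
  assumes "complete S" "convex S" "S \<noteq> {}"
  shows "\<exists>x\<in>S. \<forall>y\<in>S. dist v x \<le> dist v y"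
proof -
  define d where "d = (INF x\<in>S. (norm (v - x))\<^sup>2)"
  have bdd: "bdd_below ((\<lambda>x. (norm (v - x))\<^sup>2) ` S)"
    by (rule bdd_belowI2[where m = 0]) simp
  have d_le: "d \<le> (norm (v - y))\<^sup>2" if "y \<in> S" for y
    unfolding d_def using bdd that by (rule cINF_lower)
  have "\<exists>x\<in>S. (norm (v - x))\<^sup>2 < d + e" if "e > 0" for e
    using cINF_less_iff[OF assms(3) bdd, of "d + e"] that by (simp add: d_def)
  then have "\<exists>x. x \<in> S \<and> (norm (v - x))\<^sup>2 < d + 1 / real (Suc n)" for n
    by (metis of_nat_0_less_iff zero_less_Suc zero_less_divide_1_iff)
  then obtain x where xS: "x n \<in> S" and x_less: "(norm (v - x n))\<^sup>2 < d + 1 / real (Suc n)" for n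
    by metis
  have gap: "(norm (x m - x n))\<^sup>2 \<le> 2 / real (Suc m) + 2 / real (Suc n)" for m n
  proof -
    define z where "z = (1/2) *\<^sub>R x m + (1/2) *\<^sub>R x n"
    have "z \<in> S"
      unfolding z_def using assms(2) xS by (intro convexD) auto
    have "2 *\<^sub>R (v - z) = (v - x m) + (v - x n)"
      by (simp add: z_def scaleR_right_diff_distrib scaleR_right_distrib scaleR_2)
    then have "4 * (norm (v - z))\<^sup>2 = (norm ((v - x m) + (v - x n)))\<^sup>2"
      by (metis norm_scaleR abs_numeral power_mult_distrib four_x_squared)
    moreover have "(norm (x m - x n))\<^sup>2 = (norm ((v - x m) - (v - x n)))\<^sup>2"
      by (simp add: norm_minus_commute)
    ultimately have "(norm (x m - x n))\<^sup>2
        = 2 * (norm (v - x m))\<^sup>2 + 2 * (norm (v - x n))\<^sup>2 - 4 * (norm (v - z))\<^sup>2"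
      using parallelogram_law[of "v - x m" "v - x n"] by linarith
    then show ?thesis
      using d_le[OF \<open>z \<in> S\<close>] x_less[of m] x_less[of n] by simp
  qed
  have "Cauchy x"
    unfolding Cauchy_altdef
  proof (intro allI impI)
    fix e :: real
    assume "e > 0"
    then obtain N where N: "4 / e\<^sup>2 < real N"
      using reals_Archimedean2 by blast
    have "dist (x m) (x n) < e" if "m \<ge> N" "n > m" for m n
    proof -
      have "2 / real (Suc m) + 2 / real (Suc n) \<le> 2 / real (Suc N) + 2 / real (Suc N)"
        using that by (intro add_mono divide_left_mono) auto
      also have "\<dots> = 4 / real (Suc N)"
        by simp
      also have "\<dots> < e\<^sup>2"
        using N \<open>e > 0\<close> by (simp add: field_simps add_strict_increasing)
      finally have "(norm (x m - x n))\<^sup>2 < e\<^sup>2"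
        using gap[of m n] by linarith
      then show ?thesis
        using \<open>e > 0\<close> by (simp add: dist_norm power2_less_imp_less)
    qed
    then show "\<exists>M. \<forall>m\<ge>M. \<forall>n>m. dist (x m) (x n) < e"
      by blast
  qed
  with assms(1) xS obtain l where "l \<in> S" and l: "x \<longlonglongrightarrow> l"
    unfolding complete_def by blast
  have "(\<lambda>n. (norm (v - x n))\<^sup>2) \<longlonglongrightarrow> (norm (v - l))\<^sup>2"
    using l by (intro tendsto_intros)
  moreover have "(\<lambda>n. d + 1 / real (Suc n)) \<longlonglongrightarrow> d + 0"
    by (intro tendsto_intros LIMSEQ_inverse_real_of_nat[unfolded inverse_eq_divide])
  ultimately have l_le: "(norm (v - l))\<^sup>2 \<le> d + 0"
    by (rule LIMSEQ_le) (use x_less in \<open>blast intro: less_imp_le\<close>)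
  have "norm (v - l) \<le> norm (v - y)" if "y \<in> S" for y
  proof (rule power2_le_imp_le)
    show "(norm (v - l))\<^sup>2 \<le> (norm (v - y))\<^sup>2"
      using l_le d_le[OF that] by linarith
  qed simp
  with \<open>l \<in> S\<close> show ?thesis
    unfolding dist_norm by blast
qed

lemma projection_in_set:
  fixes S :: "'h::real_inner set"
  assumes "complete S" "convex S" "S \<noteq> {}"
  shows "projection S v \<in> S"
proof -
  have "\<exists>x. x \<in> S \<and> (\<forall>y\<in>S. dist v x \<le> dist v y)"
    using nearest_point_exists[OF assms] by blast
  from someI_ex[OF this] show ?thesis
    by (simp add: projection_def)
qed

lemma solution_set_eq_Inter:
  "solution_set I\<^sub>1 I\<^sub>2 g f p =
     (\<Inter>i\<in>I\<^sub>1. {x. g i p \<bullet> x = f i p}) \<inter> (\<Inter>i\<in>I\<^sub>2. {x. g i p \<bullet> x \<le> f i p})"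
  by (auto simp: solution_set_def inner_commute)

lemma closed_solution_set: "closed (solution_set I\<^sub>1 I\<^sub>2 g f p)"
  unfolding solution_set_eq_Inter
  by (intro closed_Int closed_INT ballI closed_hyperplane closed_halfspace_le)

lemma convex_solution_set: "convex (solution_set I\<^sub>1 I\<^sub>2 g f p)"
  unfolding solution_set_eq_Inter
  by (intro convex_Int convex_INT convex_hyperplane convex_halfspace_le)

lemma solution_set_tighten:
  assumes "x \<in> solution_set I\<^sub>1 I\<^sub>2 g f p" "M \<subseteq> active_set I\<^sub>1 I\<^sub>2 g f p x"
  shows "x \<in> solution_set (I\<^sub>1 \<union> M) (I\<^sub>2 - M) g f p"
  using assms by (auto simp: solution_set_def active_set_def)

theorem theorem5p4:
  fixes D :: "'p::real_normed_vector set"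
    and q m :: nat
    and I\<^sub>1 I\<^sub>2 :: "nat set"
    and f :: "nat \<Rightarrow> 'p \<Rightarrow> real"
    and g :: "nat \<Rightarrow> 'p \<Rightarrow> 'h::{real_inner, complete_space}"
    and C :: "'p \<Rightarrow> 'h set"
    and P :: "'h \<Rightarrow> 'p \<Rightarrow> 'h"
    and pbar :: 'p and vbar :: 'h
    and J\<^sub>1 J\<^sub>2 Kbar :: "'i set"
    and ft :: "'i \<Rightarrow> 'p \<Rightarrow> real"
    and gt :: "'i \<Rightarrow> 'p \<Rightarrow> 'h"
    and lam :: "'i \<Rightarrow> real"
    and U :: "'p set" and W :: "'h set"
  assumes I1: "I\<^sub>1 = {} \<or> I\<^sub>1 = {1..q}"
    and I2: "I\<^sub>2 = {} \<or> I\<^sub>2 = {q+1..m}"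
    and I_nonempty: "I\<^sub>1 \<union> I\<^sub>2 \<noteq> {}"
    and lipschitz: "\<And>i. i \<in> I\<^sub>1 \<union> I\<^sub>2 \<Longrightarrow>
          locally_lipschitz_on D (f i) \<and> locally_lipschitz_on D (g i)"
    and C: "\<And>p. p \<in> D \<Longrightarrow> C p = solution_set I\<^sub>1 I\<^sub>2 g f p"
    and C_nonempty: "\<And>p. p \<in> D \<Longrightarrow> C p \<noteq> {}"
    and P: "\<And>v p. p \<in> D \<Longrightarrow> P v p = projection (C p) v"
    and pbar: "pbar \<in> D"
    and vbar: "vbar \<notin> C pbar"
    and representation: "equivalent_representation D C J\<^sub>1 J\<^sub>2 gt ft"
    and Kbar: "Kbar \<subseteq> J\<^sub>2 \<inter> active_set J\<^sub>1 J\<^sub>2 gt ft pbar (P vbar pbar)"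
    and lam_sum: "vbar - P vbar pbar = (\<Sum>i\<in>J\<^sub>1 \<union> Kbar. lam i *\<^sub>R gt i pbar)"
    and lam_pos: "\<And>i. i \<in> Kbar \<Longrightarrow> lam i > 0"
    and Kbar_indep: "lin_indep_family (\<lambda>i. gt i pbar) (J\<^sub>1 \<union> Kbar)"
    and U: "U \<subseteq> D" "pbar \<in> top_of_set D interior_of U"
    and W: "vbar \<in> interior W"
    and a: "\<And>p v. p \<in> U \<Longrightarrow> v \<in> W \<Longrightarrow> Kbar \<subseteq> active_set J\<^sub>1 J\<^sub>2 gt ft p (P v p)"
    and b: "\<And>(s :: nat \<Rightarrow> 'p) L.
          (\<And>n. s n \<in> D) \<Longrightarrow> s \<longlonglongrightarrow> pbar \<Longrightarrow>
          L \<subseteq> (J\<^sub>2 \<inter> active_set J\<^sub>1 J\<^sub>2 gt ft pbar (P vbar pbar)) - Kbar \<Longrightarrow>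
          lin_indep_family (\<lambda>i. gt i pbar) (J\<^sub>1 \<union> Kbar \<union> L) \<Longrightarrow>
          \<exists>v :: nat \<Rightarrow> 'h. v \<longlonglongrightarrow> vbar \<and>
            (\<forall>\<^sub>F n in sequentially. L \<subseteq> active_set J\<^sub>1 J\<^sub>2 gt ft (s n) (P (v n) (s n)))"
    and P_continuous: "continuous (at (vbar, pbar) within UNIV \<times> D) (\<lambda>(v, p). P v p)"
  shows "stable_representation D C J\<^sub>1 J\<^sub>2 gt ft pbar vbar (P vbar pbar)"
proof -
  have P_in_C: "P v p \<in> C p" if "p \<in> D" for p v
  proof -
    have "projection (C p) v \<in> C p"
    proof (rule projection_in_set)
      show "complete (C p)" "convex (C p)"
        unfolding C[OF that] complete_eq_closed
        by (rule closed_solution_set convex_solution_set)+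
    qed (rule C_nonempty[OF that])
    then show ?thesis
      unfolding P[OF that] .
  qed
  have C_eq: "solution_set J\<^sub>1 J\<^sub>2 gt ft p = C p" if "p \<in> D" for p
    using representation that by (simp add: equivalent_representation_def)
  have limit: "P vbar pbar \<in>
      lower_limit D (solution_set (J\<^sub>1 \<union> Kbar \<union> L) (J\<^sub>2 - (Kbar \<union> L)) gt ft) pbar"
    if L: "L \<subseteq> (active_set J\<^sub>1 J\<^sub>2 gt ft pbar (P vbar pbar) \<inter> J\<^sub>2) - Kbar"
      and indep: "lin_indep_family (\<lambda>i. gt i pbar) (J\<^sub>1 \<union> Kbar \<union> L)" for L
    unfolding lower_limit_def
  proof (intro CollectI allI impI, elim conjE)
    fix s :: "nat \<Rightarrow> 'p"
    assume sD: "\<forall>k. s k \<in> D" and s: "s \<longlonglongrightarrow> pbar"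
    obtain v where v: "v \<longlonglongrightarrow> vbar"
      and L_active: "\<forall>\<^sub>F n in sequentially. L \<subseteq> active_set J\<^sub>1 J\<^sub>2 gt ft (s n) (P (v n) (s n))"
      using b[of s L] sD s L indep by (auto simp: Int_commute)
    have "\<forall>\<^sub>F n in sequentially. s n \<in> U"
    proof -
      obtain T where T: "open T" "pbar \<in> T" "D \<inter> T \<subseteq> U"
        using U(2) by (auto simp: interior_of_def openin_open)
      have "\<forall>\<^sub>F n in sequentially. s n \<in> T"
        using s T(1,2) by (rule topological_tendstoD)
      then show ?thesis
        by eventually_elim (use sD T(3) in auto)
    qed
    moreover have "\<forall>\<^sub>F n in sequentially. v n \<in> W"
      using topological_tendstoD[OF v open_interior W]
      by eventually_elim (use interior_subset in blast)
    ultimately have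
      "\<forall>\<^sub>F n in sequentially.
         P (v n) (s n) \<in> solution_set (J\<^sub>1 \<union> Kbar \<union> L) (J\<^sub>2 - (Kbar \<union> L)) gt ft (s n)"
      using L_active
    proof eventually_elim
      case (elim n)
      then have "Kbar \<union> L \<subseteq> active_set J\<^sub>1 J\<^sub>2 gt ft (s n) (P (v n) (s n))"
        using a by blast
      with solution_set_tighten[of "P (v n) (s n)" J\<^sub>1 J\<^sub>2 gt ft "s n"] P_in_C C_eq sD
      show ?case
        by (simp add: Un_assoc)
    qed
    moreover have "(\<lambda>n. P (v n) (s n)) \<longlonglongrightarrow> P vbar pbar"
      using continuous_within_tendsto_compose[OF P_continuous, of "\<lambda>n. (v n, s n)" sequentially]
        sD tendsto_Pair[OF v s] by simp
    ultimately show "\<exists>y. (\<forall>\<^sub>F k in sequentially.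
        y k \<in> solution_set (J\<^sub>1 \<union> Kbar \<union> L) (J\<^sub>2 - (Kbar \<union> L)) gt ft (s k)) \<and> y \<longlonglongrightarrow> P vbar pbar"
      by (intro exI[of _ "\<lambda>n. P (v n) (s n)"] conjI)
  qed
  have "Kbar \<subseteq> active_set J\<^sub>1 J\<^sub>2 gt ft pbar (P vbar pbar) \<inter> J\<^sub>2"
    using Kbar by blast
  moreover have "\<exists>c. vbar - P vbar pbar = (\<Sum>i\<in>J\<^sub>1 \<union> Kbar. c i *\<^sub>R gt i pbar) \<and> (\<forall>i\<in>Kbar. c i > 0)"
    using lam_sum lam_pos by blast
  ultimately show ?thesis
    unfolding stable_representation_def
    by (intro conjI representation pbar vbar P_in_C[OF pbar] exI[of _ Kbar] Kbar_indep)
      (use limit in simp_all)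
qed

end
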